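(* There exist an integer $k$ and a $k$-SAT formula $\Phi$ such that, for the probability space $\Omega$ in which the variables of $\Phi$ are independent and each equals $T$ with probability $1/2$, and for the collection $\mathcal B$ of bad-events consisting of, for each clause of $\Phi$, the event that this clause is false, both of the following hold: (1) there is a function $\mu:\mathcal B\to[0,\infty)$ such that for every $B\in\mathcal B$, $$\mu(B)\ \ge\ \Pr(B)\Bigl(\mu(B)+\sum_{Y\text{ orderable to }B}\ \prod_{A\in Y}\mu(A)\Bigr);$$ (2) Shearer's criterion is violated by $G,\vec p$, where $G$ is the canonical lopsidependency graph of $\mathcal B$ and $p_B=\Pr(B)=2^{-k}$ for all $B\in\mathcal B$.
   Context: A $k$-SAT formula ($k$-CNF formula) is a conjunction of finitely many clauses, each clause being a disjunction of $k$ distinct literals (a literal is $X_j$ or $\neg X_j$ for a boolean variable $X_j$). The event that a clause is false is a monomial event $B\equiv (X_{i_1}=j_1)\wedge\dots\wedge(X_{i_k}=j_k)$ with $j_1,\dots,j_k\in\{T,F\}$, and $\mathrm{var}(B)=\{i_1,\dots,i_k\}$. Two monomial events $B,B'$ disagree on variable $i$ if $B$ demands $X_i=j$ and $B'$ demands $X_i=j'$ with $j\ne j'$. Canonical lopsidependency graph: the graph on vertex set $\mathcal B$ with an edge between $B$ and $B'$ iff they disagree on some variable $i\in \mathrm{var}(B)\cap\mathrm{var}(B')$. Orderability: a set $Y\subseteq\mathcal B$ is orderable to $B\in\mathcal B$ if there is an ordering $Y=\{B_1,\dots,B_s\}$ such that for each $i=1,\dots,s$ there is a variable $z_i\in\mathrm{var}(B)\cap\mathrm{var}(B_i)$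 on which $B$ disagrees with $B_i$ but $B$ does not disagree with any of $B_1,\dots,B_{i-1}$ on $z_i$. (The empty set is orderable to every $B$, and empty products are $1$.) Shearer's criterion: for a finite graph $G$ on vertex set $V$, a set of vertices is stable if no two of its elements are adjacent. For reals $p_v$ ($v\in V$) and $S\subseteq V$, let $$Q(G,S,\vec p)=\sum_{T\text{ stable},\ S\subseteq T\subseteq V}(-1)^{|T|-|S|}\prod_{v\in T}p_v .$$ Shearer's criterion is violated by $G,\vec p$ if either $Q(G,\emptyset,\vec p)\le 0$ or there is a stable set $S\subseteq V$ with $Q(G,S,\vec p)<0$. *)

theory Defs
  imports Complex_Main "HOL-Probability.Probability"
begin

section \<open>k-SAT formulas\<close>

datatype 'v literal = Pos 'v | Neg 'v

type_synonym 'v clause = "'v literal set"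

fun lit_var :: "'v literal \<Rightarrow> 'v" where
  "lit_var (Pos i) = i"
| "lit_var (Neg i) = i"

fun lit_true :: "('v \<Rightarrow> bool) \<Rightarrow> 'v literal \<Rightarrow> bool" where
  "lit_true \<omega> (Pos i) = \<omega> i"
| "lit_true \<omega> (Neg i) = (\<not> \<omega> i)"

definition clause_true :: "('v \<Rightarrow> bool) \<Rightarrow> 'v clause \<Rightarrow> bool" where
  "clause_true \<omega> C \<longleftrightarrow> (\<exists>l\<in>C. lit_true \<omega> l)"

text \<open>Complementary literals are excluded: otherwise the clause could not be false, and its
  falsity would not be a monomial event on \<open>k\<close> variables.\<close>

definition k_clause :: "nat \<Rightarrow> 'v clause \<Rightarrow> bool" where
  "k_clause k C \<longleftrightarrow> finite C \<and> card C = k \<and> (\<nexists>i. Pos i \<in> C \<and> Neg i \<in> C)"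

definition k_sat_formula :: "nat \<Rightarrow> 'v clause set \<Rightarrow> bool" where
  "k_sat_formula k \<Phi> \<longleftrightarrow> finite \<Phi> \<and> (\<forall>C\<in>\<Phi>. k_clause k C)"

definition formula_vars :: "'v clause set \<Rightarrow> 'v set" where
  "formula_vars \<Phi> = (\<Union>C\<in>\<Phi>. lit_var ` C)"

section \<open>Monomial events\<close>

text \<open>A monomial event is given by its set of demands; \<open>(i, j) \<in> B\<close> means that \<open>B\<close> demands
  \<open>X\<^sub>i = j\<close>.\<close>

type_synonym 'v monomial = "('v \<times> bool) set"

definition event_of :: "'v monomial \<Rightarrow> ('v \<Rightarrow> bool) set" where
  "event_of B = {\<omega>. \<forall>(i, j)\<in>B. \<omega> i = j}"

definition var :: "'v monomial \<Rightarrow> 'v set" where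
  "var B = fst ` B"

definition disagree_on :: "'v monomial \<Rightarrow> 'v monomial \<Rightarrow> 'v \<Rightarrow> bool" where
  "disagree_on B B' i \<longleftrightarrow> (\<exists>j j'. (i, j) \<in> B \<and> (i, j') \<in> B' \<and> j \<noteq> j')"

fun falsify :: "'v literal \<Rightarrow> 'v \<times> bool" where
  "falsify (Pos i) = (i, False)"
| "falsify (Neg i) = (i, True)"

definition bad_event :: "'v clause \<Rightarrow> 'v monomial" where
  "bad_event C = falsify ` C"

lemma event_of_bad_event: "event_of (bad_event C) = {\<omega>. \<not> clause_true \<omega> C}"
proof -
  have "(case falsify l of (i, j) \<Rightarrow> \<omega> i = j) \<longleftrightarrow> \<not> lit_true \<omega> l" for \<omega> :: "'a \<Rightarrow> bool" and l
    by (cases l) auto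
  then show ?thesis
    by (simp add: event_of_def bad_event_def clause_true_def)
qed

definition bad_events :: "'v clause set \<Rightarrow> 'v monomial set" where
  "bad_events \<Phi> = bad_event ` \<Phi>"

text \<open>Variables that do not occur in \<open>\<Phi>\<close> get the irrelevant constant value \<open>False\<close>.\<close>

definition assignment_space :: "'v clause set \<Rightarrow> ('v \<Rightarrow> bool) pmf" where
  "assignment_space \<Phi> = Pi_pmf (formula_vars \<Phi>) False (\<lambda>_. bernoulli_pmf (1/2))"

definition Pr :: "'v clause set \<Rightarrow> 'v monomial \<Rightarrow> real" where
  "Pr \<Phi> B = measure_pmf.prob (assignment_space \<Phi>) (event_of B)"

section \<open>Orderability and the canonical lopsidependency graph\<close>

definition orderable :: "'v monomial set \<Rightarrow> 'v monomial \<Rightarrow> bool" where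
  "orderable Y B \<longleftrightarrow>
     (\<exists>Bs. distinct Bs \<and> set Bs = Y \<and>
        (\<forall>i<length Bs. \<exists>z \<in> var B \<inter> var (Bs ! i).
            disagree_on B (Bs ! i) z \<and> (\<forall>j<i. \<not> disagree_on B (Bs ! j) z)))"

text \<open>The adjacency relation of the graph; the vertex set is supplied separately.\<close>

definition lopsi_adj :: "'v monomial \<Rightarrow> 'v monomial \<Rightarrow> bool" where
  "lopsi_adj B B' \<longleftrightarrow> (\<exists>i \<in> var B \<inter> var B'. disagree_on B B' i)"

section \<open>Shearer's criterion\<close>

definition stable :: "('a \<Rightarrow> 'a \<Rightarrow> bool) \<Rightarrow> 'a set \<Rightarrow> bool" where
  "stable adj T \<longleftrightarrow> (\<forall>u\<in>T. \<forall>v\<in>T. u \<noteq> v \<longrightarrow> \<not> adj u v)"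

definition shearer_Q :: "'a set \<Rightarrow> ('a \<Rightarrow> 'a \<Rightarrow> bool) \<Rightarrow> 'a set \<Rightarrow> ('a \<Rightarrow> real) \<Rightarrow> real" where
  "shearer_Q V adj S p =
     (\<Sum>T | stable adj T \<and> S \<subseteq> T \<and> T \<subseteq> V. (-1) ^ (card T - card S) * (\<Prod>v\<in>T. p v))"

definition shearer_violated :: "'a set \<Rightarrow> ('a \<Rightarrow> 'a \<Rightarrow> bool) \<Rightarrow> ('a \<Rightarrow> real) \<Rightarrow> bool" where
  "shearer_violated V adj p \<longleftrightarrow>
     shearer_Q V adj {} p \<le> 0 \<or> (\<exists>S\<subseteq>V. stable adj S \<and> shearer_Q V adj S p < 0)"

end

theory Submission
  imports Defs
begin

text \<open>
  Take clauses of two kinds, those containing \<open>X\<^sub>0\<close> and those containing \<open>\<not> X\<^sub>0\<close>, such that all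
  disagreements happen on variable \<open>0\<close>. With \<open>l\<close> clauses of each kind the lopsidependency graph is
  the complete bipartite graph \<open>K\<^bsub>l,l\<^esub>\<close>, and two neighbours of \<open>B\<close> can never be ordered, since they
  compete for the only available variable. With constant weight \<open>\<mu>\<close>, orderability thus asks for
  \<open>\<mu> \<ge> p (\<mu> + 1 + l \<mu>)\<close>, which is solvable as long as \<open>l p < 1 - p\<close>. Shearer's criterion however sees the
  \<open>2\<^sup>l\<close> stable sets of each side, and its polynomial \<open>2 (1 - p)\<^sup>l - 1\<close> becomes negative already at
  about \<open>l p = ln 2\<close>. We use \<open>p = 1/8\<close> and \<open>l = 6\<close>, the six clauses of each kind being given by the
  pairs of variables from \<open>{1..4}\<close>.
\<close>

section \<open>Probability of a monomial event\<close>

text \<open>The event is a product of one-variable constraints, so independence gives a factor 1/2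
  for each constrained variable. Injectivity of \<open>fst\<close> on \<open>B\<close> rules out
  contradictory demands and makes demands and variables equinumerous.\<close>

lemma prob_assignment_monomial:
  assumes "finite V" and "B \<subseteq> V \<times> UNIV" and "inj_on fst B"
  shows "measure_pmf.prob (Pi_pmf V d (\<lambda>_. bernoulli_pmf (1/2))) (event_of B) = 1 / 2 ^ card B"
proof -
  define D where "D i = {j. \<forall>j'. (i, j') \<in> B \<longrightarrow> j = j'}" for i
  have "event_of B = Pi V D"
    using assms(2) by (fastforce simp: event_of_def D_def Pi_def)
  moreover have "measure_pmf.prob (bernoulli_pmf (1/2)) (D i) = (if i \<in> fst ` B then 1/2 else 1)" for i
  proof (cases "i \<in> fst ` B")
    case True
    then obtain j where "(i, j) \<in> B" by auto
    moreover from this have "j' = j" if "(i, j') \<in> B" for j'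
      using inj_onD[OF assms(3), of "(i, j')" "(i, j)"] that by simp
    ultimately have "D i = {j}"
      unfolding D_def by blast
    then show ?thesis
      using True by (cases j) (simp_all add: measure_pmf_single)
  next
    case False
    then have "D i = UNIV"
      by (force simp: D_def image_iff)
    then show ?thesis
      using False by simp
  qed
  moreover have "(\<Prod>i\<in>V. if i \<in> fst ` B then 1/2 else 1 :: real) = 1 / 2 ^ card B"
  proof -
    have "V \<inter> fst ` B = fst ` B" using assms(2) by auto
    then have "(\<Prod>i\<in>V. if i \<in> fst ` B then 1/2 else 1 :: real) = (\<Prod>i\<in>fst ` B. 1/2)"
      using assms(1) by (simp flip: prod.inter_restrict)
    also have "\<dots> = 1 / 2 ^ card B"
      by (simp add: card_image[OF assms(3)] power_one_over)
    finally show ?thesis .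
  qed
  ultimately show ?thesis
    using assms(1) by (simp add: measure_Pi_pmf_Pi)
qed

lemma fst_falsify: "fst (falsify l) = lit_var l"
  by (cases l) auto

lemma inj_on_lit_var: "k_clause k C \<Longrightarrow> inj_on lit_var C"
  unfolding k_clause_def inj_on_def by (metis lit_var.elims)

lemma Pr_bad_event:
  assumes "k_sat_formula k \<Phi>" and "C \<in> \<Phi>"
  shows "Pr \<Phi> (bad_event C) = 1 / 2 ^ k"
proof -
  have C: "k_clause k C" and "finite \<Phi>" and fin: "\<And>C. C \<in> \<Phi> \<Longrightarrow> finite C"
    using assms by (auto simp: k_sat_formula_def k_clause_def)
  then have "finite (formula_vars \<Phi>)"
    by (auto simp: formula_vars_def)
  moreover have "bad_event C \<subseteq> formula_vars \<Phi> \<times> UNIV"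
    using assms(2) by (auto simp: bad_event_def formula_vars_def image_subset_iff mem_Times_iff fst_falsify)
  moreover have inj: "inj_on (fst \<circ> falsify) C"
    using inj_on_lit_var[OF C] by (simp add: inj_on_def fst_falsify)
  moreover have "card (bad_event C) = k"
    using C card_image[OF inj_on_imageI2[OF inj]] by (simp add: bad_event_def k_clause_def)
  ultimately show ?thesis
    by (simp add: Pr_def assignment_space_def prob_assignment_monomial bad_event_def inj_on_imageI)
qed

section \<open>Shearer's polynomial and orderability in the abstract\<close>

text \<open>A stable set lies within one side, and the signed sum over the subsets of a side factors
  as a product of terms \<open>1 - p v\<close>. The final \<open>- 1\<close> corrects for the empty
  set, which belongs to both sides.\<close>

lemma shearer_Q_biclique:
  assumes "finite A" "finite B" "A \<inter> B = {}"
    and stable: "stable adj A" "stable adj B"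
    and adj: "\<And>a b. a \<in> A \<Longrightarrow> b \<in> B \<Longrightarrow> adj a b"
  shows "shearer_Q (A \<union> B) adj {} p = (\<Prod>a\<in>A. 1 - p a) + (\<Prod>b\<in>B. 1 - p b) - 1"
proof -
  have expand: "(\<Sum>T\<in>Pow S. (-1) ^ card T * (\<Prod>v\<in>T. p v)) = (\<Prod>v\<in>S. 1 - p v)" if "finite S" for S
    using prod_diff_conv_sum[OF that, of "\<lambda>_. 1" p] by simp
  have "{T. stable adj T \<and> {} \<subseteq> T \<and> T \<subseteq> A \<union> B} = Pow A \<union> Pow B"
  proof (intro set_eqI iffI)
    fix T assume "T \<in> {T. stable adj T \<and> {} \<subseteq> T \<and> T \<subseteq> A \<union> B}"
    then have T: "stable adj T" "T \<subseteq> A \<union> B" by auto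
    have "a \<notin> T \<or> b \<notin> T" if "a \<in> A" "b \<in> B" for a b
    proof -
      have "a \<noteq> b" using that assms(3) by auto
      then show ?thesis
        using T(1) adj[OF that] by (auto simp: stable_def)
    qed
    then show "T \<in> Pow A \<union> Pow B"
      using T(2) by blast
  qed (use stable in \<open>auto simp: stable_def subset_iff\<close>)
  moreover have "Pow A \<inter> Pow B = {{}}"
    using assms(3) by auto
  ultimately show ?thesis
    using assms(1,2) by (simp add: shearer_Q_def sum_Un expand)
qed

text \<open>Every member of an ordering must take \<open>x\<close> as its witness, but a second
  member would need the first not to disagree on \<open>x\<close>.\<close>

lemma orderable_unique_variable:
  assumes "orderable Y B" and "\<And>A z. A \<in> Y \<Longrightarrow> disagree_on B A z \<Longrightarrow> z = x"
  shows "Y = {} \<or> (\<exists>A. Y = {A} \<and> disagree_on B A x)"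
proof -
  obtain Bs where Bs: "set Bs = Y" and ord: "\<And>i. i < length Bs \<Longrightarrow>
      \<exists>z \<in> var B \<inter> var (Bs ! i). disagree_on B (Bs ! i) z \<and> (\<forall>j<i. \<not> disagree_on B (Bs ! j) z)"
    using assms(1) unfolding orderable_def by blast
  have x: "disagree_on B (Bs ! i) x \<and> (\<forall>j<i. \<not> disagree_on B (Bs ! j) x)" if "i < length Bs" for i
    using ord[OF that] assms(2)[of "Bs ! i"] nth_mem[OF that] Bs by blast
  consider "Bs = []" | A where "Bs = [A]" | A A' As where "Bs = A # A' # As"
    by (metis list.exhaust)
  then show ?thesis
  proof cases
    case 2
    then show ?thesis using x[of 0] Bs by auto
  next
    case 3
    then show ?thesis using x[of 0] x[of 1] by auto
  qed (use Bs in auto)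
qed

section \<open>The formula and its two sides\<close>

definition pairs :: "nat set set" where
  "pairs = {P. P \<subseteq> {1..4} \<and> card P = 2}"

text \<open>The flag \<open>s\<close> is the value that the bad event demands of variable 0; this is
  why \<open>True\<close> selects \<open>Neg 0\<close>.\<close>

definition pair_clause :: "bool \<Rightarrow> nat set \<Rightarrow> nat clause" where
  "pair_clause s P = insert (if s then Neg 0 else Pos 0) (Pos ` P)"

definition pair_formula :: "nat clause set" where
  "pair_formula = pair_clause False ` pairs \<union> pair_clause True ` pairs"

definition side :: "bool \<Rightarrow> nat monomial set" where
  "side s = (bad_event \<circ> pair_clause s) ` pairs"

lemma bad_event_pair_clause:
  "bad_event (pair_clause s P) = insert (0, s) ((\<lambda>i. (i, False)) ` P)"
  by (auto simp: bad_event_def pair_clause_def image_image)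

lemma bad_events_pair_formula: "bad_events pair_formula = side False \<union> side True"
  by (simp add: bad_events_def pair_formula_def side_def image_Un image_comp)

lemma pairs_pos: "P \<in> pairs \<Longrightarrow> 0 \<notin> P"
  by (auto simp: pairs_def)

lemma finite_pairs: "finite pairs"
  by (simp add: pairs_def)

lemma card_pairs: "card pairs = 6"
  unfolding pairs_def by (simp add: n_subsets numeral_eq_Suc)

lemma finite_side: "finite (side s)"
  by (simp add: side_def finite_pairs)

lemma card_side: "card (side s) = 6"
proof -
  have "inj_on (bad_event \<circ> pair_clause s) pairs"
    \<comment> \<open>Removing 0 from the variables of the bad event recovers the pair.\<close>
    by (rule inj_on_inverseI[where g = "\<lambda>B. fst ` B - {0}"])
      (auto simp: bad_event_pair_clause image_image pairs_pos)
  then show ?thesis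
    by (simp only: side_def card_image card_pairs)
qed

text \<open>Pairs avoid 0, and every demand on another variable has value \<open>False\<close>, so
  only variable 0 can be contested.\<close>

lemma disagree_on_side:
  assumes "A \<in> side s" "B \<in> side t"
  shows "disagree_on A B z \<longleftrightarrow> z = 0 \<and> s \<noteq> t"
  using assms by (auto simp: side_def bad_event_pair_clause disagree_on_def dest: pairs_pos)

lemma lopsi_adj_side:
  assumes "A \<in> side s" "B \<in> side t"
  shows "lopsi_adj A B \<longleftrightarrow> s \<noteq> t"
proof -
  have "0 \<in> var A \<inter> var B"
    using assms by (auto simp: side_def bad_event_pair_clause var_def)
  then show ?thesis
    by (auto simp: lopsi_adj_def disagree_on_side[OF assms])
qed

lemma disjoint_sides: "side False \<inter> side True = {}"
  \<comment> \<open>A common member would both disagree and not disagree with itself on variable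
    0.\<close>
  using disagree_on_side[of _ False _ True 0] disagree_on_side[of _ False _ False 0] by auto

lemma orderable_side:
  assumes "B \<in> side s"
  shows "{Y. Y \<subseteq> bad_events pair_formula \<and> orderable Y B} = insert {} ((\<lambda>A. {A}) ` side (\<not> s))"
proof (intro set_eqI iffI)
  fix Y assume "Y \<in> {Y. Y \<subseteq> bad_events pair_formula \<and> orderable Y B}"
  then have Y: "Y \<subseteq> side s \<union> side (\<not> s)" and ord: "orderable Y B"
    by (cases s; auto simp: bad_events_pair_formula)+
  have "z = 0" if "A \<in> Y" "disagree_on B A z" for A z
    using that Y disagree_on_side[OF assms] by blast
  then have "Y = {} \<or> (\<exists>A. Y = {A} \<and> disagree_on B A 0)"
    using orderable_unique_variable[OF ord] by simp
  then consider "Y = {}" | A where "Y = {A}" "disagree_on B A 0" by metis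
  then show "Y \<in> insert {} ((\<lambda>A. {A}) ` side (\<not> s))"
  proof cases
    case 2
    then have "A \<notin> side s"
      using disagree_on_side[OF assms, of A s] by auto
    then show ?thesis
      using 2 Y by auto
  qed simp
next
  fix Y assume "Y \<in> insert {} ((\<lambda>A. {A}) ` side (\<not> s))"
  then consider "Y = {}" | A where "Y = {A}" "A \<in> side (\<not> s)" by auto
  then show "Y \<in> {Y. Y \<subseteq> bad_events pair_formula \<and> orderable Y B}"
  proof cases
    case 1
    then show ?thesis by (auto simp: orderable_def)
  next
    case 2
    then have "\<exists>z \<in> var B \<inter> var A. disagree_on B A z"
      using lopsi_adj_side[OF assms] by (simp add: lopsi_adj_def)
    then have "orderable Y B"
      unfolding orderable_def by (intro exI[of _ "[A]"]) (simp add: 2)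
    then show ?thesis
      using 2 by (cases s) (auto simp: bad_events_pair_formula)
  qed
qed

section \<open>Verification of the two criteria\<close>

lemma k_sat_pair_formula: "k_sat_formula 3 pair_formula"
proof -
  have "k_clause 3 (pair_clause s P)" if "P \<in> pairs" for s P
  proof -
    have "finite P" "card P = 2"
      using that by (auto simp: pairs_def finite_subset)
    moreover have "card (Pos ` P) = card P"
      by (simp add: card_image inj_on_def)
    ultimately show ?thesis
      using pairs_pos[OF that] by (auto simp: k_clause_def pair_clause_def card_insert_if intro: gr0I)
  qed
  then show ?thesis
    by (auto simp: k_sat_formula_def pair_formula_def finite_pairs)
qed

lemma Pr_pair_formula:
  assumes "B \<in> bad_events pair_formula"
  shows "Pr pair_formula B = 1 / 2 ^ 3"
  using assms Pr_bad_event[OF k_sat_pair_formula] unfolding bad_events_def by blast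

lemma sum_orderable_pair_formula:
  assumes "B \<in> bad_events pair_formula"
  shows "(\<Sum>Y | Y \<subseteq> bad_events pair_formula \<and> orderable Y B. \<Prod>A\<in>Y. 1 :: real) = 7"
proof -
  obtain s where "B \<in> side s"
    using assms by (auto simp: bad_events_pair_formula)
  \<comment> \<open>The empty set and the six singletons from the opposite side.\<close>
  have "card (insert {} ((\<lambda>A. {A}) ` side (\<not> s))) = 7"
    by (subst card_insert_disjoint) (auto simp: finite_side card_image card_side)
  then show ?thesis
    by (simp add: orderable_side[OF \<open>B \<in> side s\<close>])
qed

lemma shearer_violated_pair_formula:
  "shearer_violated (bad_events pair_formula) lopsi_adj (Pr pair_formula)"
proof -
  have prod: "(\<Prod>B\<in>side s. 1 - Pr pair_formula B) = (7/8) ^ 6" for s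
  proof -
    have "side s \<subseteq> bad_events pair_formula"
      by (cases s) (auto simp: bad_events_pair_formula)
    then have "(\<Prod>B\<in>side s. 1 - Pr pair_formula B) = (\<Prod>B\<in>side s. 7/8)"
      by (intro prod.cong) (auto simp: Pr_pair_formula)
    then show ?thesis
      by (simp add: card_side)
  qed
  have "stable lopsi_adj (side s)" for s
    using lopsi_adj_side[of _ s _ s] by (auto simp: stable_def)
  then have "shearer_Q (bad_events pair_formula) lopsi_adj {} (Pr pair_formula) = 2 * (7/8) ^ 6 - 1"
    unfolding bad_events_pair_formula
    by (subst shearer_Q_biclique)
      (simp_all add: finite_side disjoint_sides lopsi_adj_side[where s = False and t = True] prod)
  also have "\<dots> \<le> 0"
    by (simp add: power_divide)
  finally show ?thesis
    by (simp add: shearer_violated_def)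
qed

theorem mainTheorem1:
  "\<exists>(k::nat) (\<Phi> :: nat clause set).
     k \<ge> 1 \<and> k_sat_formula k \<Phi> \<and>
     (\<exists>\<mu> :: nat monomial \<Rightarrow> real.
        (\<forall>B \<in> bad_events \<Phi>. \<mu> B \<ge> 0) \<and>
        (\<forall>B \<in> bad_events \<Phi>.
           \<mu> B \<ge> Pr \<Phi> B * (\<mu> B + (\<Sum>Y | Y \<subseteq> bad_events \<Phi> \<and> orderable Y B. \<Prod>A\<in>Y. \<mu> A)))) \<and>
     (\<forall>B \<in> bad_events \<Phi>. Pr \<Phi> B = 1 / 2 ^ k) \<and>
     shearer_violated (bad_events \<Phi>) lopsi_adj (Pr \<Phi>)"
\<comment> \<open>The weight 1 satisfies the inequality with equality,
  \<open>1/8 * (1 + 7) = 1\<close>, and is the least constant weight that satisfies it.\<close>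
proof (intro exI[of _ 3] exI[of _ pair_formula] conjI exI[of _ "\<lambda>_. 1"] ballI)
  fix B assume B: "B \<in> bad_events pair_formula"
  show "1 \<ge> Pr pair_formula B *
      (1 + (\<Sum>Y | Y \<subseteq> bad_events pair_formula \<and> orderable Y B. \<Prod>A\<in>Y. 1))"
    by (simp only: Pr_pair_formula[OF B] sum_orderable_pair_formula[OF B]) simp
qed (simp, rule k_sat_pair_formula, simp, erule Pr_pair_formula, rule shearer_violated_pair_formula)

end
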